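(* Let $0<q<1$. The following Rogers-type formula holds for the generalized Hahn polynomials $h_n(x,y,a,b|q)$: $$\sum_{n=0}^\infty\sum_{m=0}^\infty h_{n+m}(x,y,a,b|q)\frac{t^n}{(q;q)_n}\frac{s^m}{(q;q)_m}=\widetilde{L}(a,b;\theta_{xy})\left\{\frac{(xs;q)_\infty}{(ys;q)_\infty}\;{}_2\Phi_1\left(\begin{array}{c}x/y,\,0\\ xs\end{array}\Big|\,q;yt\right)\right\}$$ $$=\widetilde{L}(a,b;\theta_{xy})\left\{\frac{(xs;q)_\infty}{(yt,ys;q)_\infty}\;{}_1\Phi_1\left(\begin{array}{c}ys\\ xs\end{array}\Big|\,q;xt\right)\right\}.$$
   Context: For complex $c$: $(c;q)_0=1$, $(c;q)_n=\prod_{i=0}^{n-1}(1-cq^i)$, $(c;q)_\infty=\prod_{i=0}^\infty(1-cq^i)$, and $(c_1,\dots,c_r;q)_n=(c_1;q)_n\cdots(c_r;q)_n$ (also for $n=\infty$). The $q$-binomial coefficient is $\left[{n\atop k}\right]_q=\dfrac{(q;q)_n}{(q;q)_k(q;q)_{n-k}}$. The Cauchy polynomials are $p_n(x,y)=(x-y)(x-qy)\cdots(x-q^{n-1}y)$, $p_0(x,y)=1$; thus $p_n(y,x)=\prod_{i=0}^{n-1}(y-q^ix)$. The generalized Hahn polynomials are $$h_n(x,y,a,b|q)=\sum_{k=0}^n\left[{n\atop k}\right]_q(-1)^kq^{\binom k2}\,b^k\,(a;q)_k\,p_{n-k}(y,x).$$ The basic hypergeometric series is $${}_r\Phi_s\left(\begin{array}{c}a_1,\dots,a_r\\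 b_1,\dots,b_s\end{array}\Big|\,q;z\right)=\sum_{n=0}^\infty\Big[(-1)^nq^{\binom n2}\Big]^{1+s-r}\frac{(a_1,\dots,a_r;q)_n}{(b_1,\dots,b_s;q)_n}\frac{z^n}{(q;q)_n}.$$ The operator $\theta_{xy}$ acts on functions of suitable variables $x$ and $y$ by $$\theta_{xy}\{f(x,y)\}=\frac{f(q^{-1}x,y)-f(x,qy)}{q^{-1}x-y},$$ and $\theta_{xy}^k$ is its $k$-th iterate. The homogeneous $q$-difference operator is $$\widetilde{L}(a,b;\theta_{xy})=\sum_{k=0}^\infty\frac{q^{\binom k2}(a;q)_k}{(q;q)_k}\,(b\,\theta_{xy})^k.$$ *)

theory Defs
  imports "HOL-Analysis.Analysis"
begin

definition qpoch :: "complex \<Rightarrow> complex \<Rightarrow> nat \<Rightarrow> complex" where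
  "qpoch c q n = (\<Prod>i<n. 1 - c * q ^ i)"

definition qpoch_inf :: "complex \<Rightarrow> complex \<Rightarrow> complex" where
  "qpoch_inf c q = (\<Prod>i. 1 - c * q ^ i)"

definition qpochs :: "complex list \<Rightarrow> complex \<Rightarrow> nat \<Rightarrow> complex" where
  "qpochs cs q n = (\<Prod>c\<leftarrow>cs. qpoch c q n)"

definition qpochs_inf :: "complex list \<Rightarrow> complex \<Rightarrow> complex" where
  "qpochs_inf cs q = (\<Prod>c\<leftarrow>cs. qpoch_inf c q)"

definition qbinomial :: "complex \<Rightarrow> nat \<Rightarrow> nat \<Rightarrow> complex" where
  "qbinomial q n k = qpoch q q n / (qpoch q q k * qpoch q q (n - k))"

definition cauchy_poly :: "complex \<Rightarrow> nat \<Rightarrow> complex \<Rightarrow> complex \<Rightarrow> complex" where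
  "cauchy_poly q n x y = (\<Prod>i<n. x - q ^ i * y)"

text \<open>The arguments of the Cauchy polynomial are swapped: \<open>p\<^sub>n\<^sub>-\<^sub>k(y, x)\<close>.\<close>

definition gen_hahn ::
  "complex \<Rightarrow> nat \<Rightarrow> complex \<Rightarrow> complex \<Rightarrow> complex \<Rightarrow> complex \<Rightarrow> complex" where
  "gen_hahn q n x y a b =
     (\<Sum>k\<le>n. qbinomial q n k * (-1) ^ k * q ^ (k choose 2) * b ^ k * qpoch a q k
              * cauchy_poly q (n - k) y x)"

text \<open>The exponent \<open>1 + s - r\<close> may be negative, hence the integer power.\<close>

definition basic_hypergeom ::
  "complex list \<Rightarrow> complex list \<Rightarrow> complex \<Rightarrow> complex \<Rightarrow> complex" where
  "basic_hypergeom as bs q z =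
     (\<Sum>n. ((-1) ^ n * q ^ (n choose 2)) powi (1 + int (length bs) - int (length as))
           * (qpochs as q n / qpochs bs q n) * (z ^ n / qpoch q q n))"

definition theta ::
  "complex \<Rightarrow> (complex \<Rightarrow> complex \<Rightarrow> complex) \<Rightarrow> complex \<Rightarrow> complex \<Rightarrow> complex" where
  "theta q f = (\<lambda>x y. (f (inverse q * x) y - f x (q * y)) / (inverse q * x - y))"

definition L_term ::
  "complex \<Rightarrow> complex \<Rightarrow> complex \<Rightarrow> (complex \<Rightarrow> complex \<Rightarrow> complex)
     \<Rightarrow> complex \<Rightarrow> complex \<Rightarrow> nat \<Rightarrow> complex" where
  "L_term q a b f x y k =
     q ^ (k choose 2) * qpoch a q k / qpoch q q k
       * ((\<lambda>g u v. b * theta q g u v) ^^ k) f x y"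

definition L_op ::
  "complex \<Rightarrow> complex \<Rightarrow> complex \<Rightarrow> (complex \<Rightarrow> complex \<Rightarrow> complex)
     \<Rightarrow> complex \<Rightarrow> complex \<Rightarrow> complex" where
  "L_op q a b f = (\<lambda>x y. \<Sum>k. L_term q a b f x y k)"

text \<open>
  The points \<open>(x, y)\<close> at which every quantity in the formula is defined.  The iterates of
  \<open>theta q\<close> evaluate the operand at \<open>(q\<^sup>-\<^sup>i x, q\<^sup>j y)\<close> and divide by
  \<open>q\<^sup>-\<^sup>i\<^sup>-\<^sup>1 x - q\<^sup>j y\<close> for all natural \<open>i\<close>, \<open>j\<close>, which has to be nonzero.  The denominators
  \<open>(q\<^sup>-\<^sup>i x s; q)\<^sub>n\<close> of the series are nonzero for all \<open>i\<close>, \<open>n\<close> iff \<open>x s\<close> is not an integer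
  power of \<open>q\<close>.  The bounds on \<open>y s\<close> and \<open>y t\<close> are those of the convergence of the
  double series and of the series with argument \<open>y t\<close>.
\<close>

definition admissible ::
  "complex \<Rightarrow> complex \<Rightarrow> complex \<Rightarrow> complex \<Rightarrow> complex \<Rightarrow> bool" where
  "admissible q x y s t \<longleftrightarrow>
     y \<noteq> 0 \<and> cmod (y * s) < 1 \<and> cmod (y * t) < 1 \<and>
     (\<forall>i j::nat. inverse q ^ Suc i * x \<noteq> q ^ j * y) \<and>
     (\<forall>k::int. x * s \<noteq> q powi k)"

end

theory Submission
  imports Defs
begin

text \<open>
  Both operands of \<open>L_op\<close> in the theorem are closed forms of one double series,
  \[ \sum_{n,m\ge 0} p_{n+m}(y,x)\,\frac{t^n}{(q;q)_n}\,\frac{s^m}{(q;q)_m}. \]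
  The Cauchy polynomials split as \<open>p\<^sub>n\<^sub>+\<^sub>m(y, x) = p\<^sub>n(y, x) p\<^sub>m(y, q\<^sup>n x)\<close>, so summing over \<open>m\<close>
  with the q-binomial theorem (\<open>q_binomial_theorem\<close>) gives the \<open>\<^sub>2\<Phi>\<^sub>1\<close> form
  (\<open>cauchy_gf_eq_2Phi1\<close>).  Summing over \<open>n\<close> instead gives a series in \<open>m\<close> with factors
  \<open>(xtq\<^sup>m; q)\<^sub>\<infinity>\<close>; expanding these by Euler's q-exponential series and exchanging the
  summations gives the \<open>\<^sub>1\<Phi>\<^sub>1\<close> form (\<open>cauchy_gf_eq_1Phi1\<close>).

  The operator acts on Cauchy polynomials as a lowering operator:
  \[ \theta_{xy}\, p_N(y,x) = -(1-q^N)\, p_{N-1}(y,x). \]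
  Hence the \<open>k\<close>-th power of \<open>b \<theta>\<close> sends \<open>p\<^sub>N\<close> to the function called \<open>theta_cauchy b k N\<close> below, and
  the sum of these over \<open>k \<le> N\<close> with the coefficients of the operator is exactly the
  generalized Hahn polynomial (\<open>gen_hahn_eq_theta_cauchy\<close>).  Since \<open>\<theta>\<close> only takes differences of
  values at shifted points, it commutes with the double series (\<open>theta_iterate\<close>).  What remains
  is to exchange the sum over \<open>k\<close> with the sum over \<open>(n, m)\<close>, and this is legitimate because the
  resulting triple series is dominated by a product of three convergent series
  (\<open>norm_summable_triple_series\<close>): the factor \<open>q^(k choose 2)\<close> beats every geometric growth in
  \<open>k\<close>, and the bounds \<open>|yt| < 1\<close>, \<open>|ys| < 1\<close> control \<open>n\<close> and \<open>m\<close>.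
\<close>

section \<open>Absolutely convergent double series\<close>

lemma norm_summable_on_times:
  fixes f :: "'a \<Rightarrow> 'c::real_normed_div_algebra" and g :: "'b \<Rightarrow> 'c"
  assumes "(\<lambda>x. norm (f x)) summable_on A" and "(\<lambda>y. norm (g y)) summable_on B"
  shows "(\<lambda>p. norm (f (fst p) * g (snd p))) summable_on (A \<times> B)"
proof -
  have "(\<Sum>\<^sub>\<infinity>y\<in>B. norm (f x * g y)) = norm (f x) * (\<Sum>\<^sub>\<infinity>y\<in>B. norm (g y))" for x
    by (simp add: norm_mult infsum_cmult_right')
  moreover have "(\<lambda>x. norm (norm (f x) * (\<Sum>\<^sub>\<infinity>y\<in>B. norm (g y)))) summable_on A"
    using summable_on_cmult_left[OF assms(1)] by (simp add: abs_mult infsum_nonneg)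
  moreover have "(\<lambda>y. norm (f x * g y)) summable_on B" for x
    using summable_on_cmult_right[OF assms(2)] by (simp add: norm_mult)
  ultimately show ?thesis
    unfolding Infinite_Sum.abs_summable_on_Sigma_iff by simp
qed

lemma infsum_nat_eq_suminf:
  fixes f :: "nat \<Rightarrow> 'a::banach"
  assumes "f summable_on UNIV"
  shows "infsum f UNIV = (\<Sum>n. f n)"
  using assms has_sum_imp_sums has_sum_infsum sums_unique by blast

text \<open>
  The bridge between unordered sums, for which Fubini holds, and iterated sums of ordinary series.
\<close>

lemma norm_summable_on_double_series:
  fixes f :: "nat \<times> nat \<Rightarrow> 'a::banach"
  assumes "(\<lambda>p. norm (f p)) summable_on UNIV"
  shows "summable (\<lambda>m. f (n, m))" and "summable (\<lambda>n. \<Sum>m. f (n, m))"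
    and "(\<Sum>n. \<Sum>m. f (n, m)) = infsum f UNIV"
proof -
  have sum: "f summable_on UNIV \<times> UNIV"
    using abs_summable_summable[OF assms] by simp
  have row: "(\<lambda>m. f (n, m)) summable_on UNIV" for n
    using assms Infinite_Sum.abs_summable_on_Sigma_iff[of f UNIV "\<lambda>_. UNIV"]
    by (intro abs_summable_summable[of "\<lambda>m. f (n, m)"]) simp
  then show "summable (\<lambda>m. f (n, m))"
    by (rule summable_on_imp_summable)
  have rows: "(\<lambda>n. \<Sum>m. f (n, m)) summable_on UNIV"
    using summable_on_Sigma_banach[of "\<lambda>n m. f (n, m)" UNIV "\<lambda>_. UNIV"] sum
    by (simp add: infsum_nat_eq_suminf[OF row])
  then show "summable (\<lambda>n. \<Sum>m. f (n, m))"
    by (rule summable_on_imp_summable)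
  show "(\<Sum>n. \<Sum>m. f (n, m)) = infsum f UNIV"
    using infsum_Sigma_banach[OF sum] infsum_nat_eq_suminf[OF rows]
    by (simp add: infsum_nat_eq_suminf[OF row])
qed

section \<open>q-shifted factorials and Cauchy polynomials\<close>

locale q_base =
  fixes q :: complex
  assumes norm_q_less_1: "cmod q < 1" and q_nonzero: "q \<noteq> 0"
begin

lemma convergent_prod_qpoch: "convergent_prod (\<lambda>i. 1 - c * q ^ i)"
proof -
  have "summable (\<lambda>i. cmod c * cmod q ^ i)"
    using norm_q_less_1 by (intro summable_mult summable_geometric) simp
  then have "abs_convergent_prod (\<lambda>i. 1 - c * q ^ i)"
    unfolding abs_convergent_prod_conv_summable by (simp add: norm_mult norm_power)
  then show ?thesis
    by (rule abs_convergent_prod_imp_convergent_prod)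
qed

lemma qpoch_tendsto: "(\<lambda>n. qpoch c q n) \<longlonglongrightarrow> qpoch_inf c q"
proof -
  have "(\<lambda>n. qpoch c q (Suc n)) \<longlonglongrightarrow> qpoch_inf c q"
    unfolding qpoch_def qpoch_inf_def lessThan_Suc_atMost
    by (rule convergent_prod_LIMSEQ[OF convergent_prod_qpoch])
  then show ?thesis
    by (rule filterlim_sequentially_Suc[THEN iffD1])
qed

lemma qpoch_inf_nonzero:
  assumes "\<And>i. c * q ^ i \<noteq> 1"
  shows "qpoch_inf c q \<noteq> 0"
  unfolding qpoch_inf_def
proof (rule prodinf_nonzero[OF convergent_prod_qpoch])
  show "1 - c * q ^ i \<noteq> 0" for i
    using assms[of i] by simp
qed

lemma mult_power_q_neq_1:
  assumes "cmod c < 1"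
  shows "c * q ^ i \<noteq> 1"
proof
  assume "c * q ^ i = 1"
  then have "cmod c * cmod q ^ i = 1"
    by (metis norm_mult norm_one norm_power)
  moreover have "cmod c * cmod q ^ i \<le> cmod c * 1"
    using norm_q_less_1 by (intro mult_left_mono power_le_one) auto
  ultimately show False
    using assms by simp
qed

lemma qpoch_inf_nonzero_disc: "cmod c < 1 \<Longrightarrow> qpoch_inf c q \<noteq> 0"
  by (intro qpoch_inf_nonzero mult_power_q_neq_1)

lemma qpoch_nonzero:
  assumes "\<And>i. c * q ^ i \<noteq> 1"
  shows "qpoch c q n \<noteq> 0"
  using assms by (simp add: qpoch_def)

lemma qpoch_q_nonzero: "qpoch q q n \<noteq> 0"
  by (intro qpoch_nonzero mult_power_q_neq_1 norm_q_less_1)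

lemma qpoch_add: "qpoch c q (n + m) = qpoch c q n * qpoch (c * q ^ n) q m"
  unfolding qpoch_def by (induction m) (auto simp: power_add mult_ac)

lemma qpoch_inf_split: "qpoch_inf c q = qpoch c q n * qpoch_inf (c * q ^ n) q"
proof (rule LIMSEQ_unique)
  show "(\<lambda>m. qpoch c q (m + n)) \<longlonglongrightarrow> qpoch_inf c q"
    by (rule LIMSEQ_ignore_initial_segment[OF qpoch_tendsto])
  show "(\<lambda>m. qpoch c q (m + n)) \<longlonglongrightarrow> qpoch c q n * qpoch_inf (c * q ^ n) q"
    unfolding add.commute[of _ n] qpoch_add by (intro tendsto_mult_left qpoch_tendsto)
qed

lemma qpoch_0_left [simp]: "qpoch 0 q n = 1"
  by (simp add: qpoch_def)

lemma qpoch_inf_0_left [simp]: "qpoch_inf 0 q = 1"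
  by (simp add: qpoch_inf_def)

lemma qpoch_bounded: "\<exists>C>0. \<forall>n. cmod (qpoch c q n) \<le> C"
  using convergent_imp_Bseq[OF convergentI[OF qpoch_tendsto]] by (simp add: Bseq_def)

text \<open>
  The sequence converges to \<open>1 / (q;q)\<^sub>\<infinity>\<close>, because the infinite product does not vanish.
\<close>

lemma inverse_qpoch_bounded: "\<exists>C>0. \<forall>n. cmod (inverse (qpoch q q n)) \<le> C"
  using convergent_imp_Bseq[OF convergentI[OF tendsto_inverse[OF qpoch_tendsto]]]
    qpoch_inf_nonzero_disc[OF norm_q_less_1] by (simp add: Bseq_def)

lemma qpoch_ratio_bounded: "\<exists>C>0. \<forall>n k. cmod (qpoch c q n / qpoch q q k) \<le> C"
proof -
  obtain C D where "C > 0" "\<And>n. cmod (qpoch c q n) \<le> C"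
    "D > 0" "\<And>n. cmod (inverse (qpoch q q n)) \<le> D"
    using qpoch_bounded[of c] inverse_qpoch_bounded by blast
  then have "cmod (qpoch c q n / qpoch q q k) \<le> C * D" for n k
    unfolding divide_inverse norm_mult by (intro mult_mono) (auto intro: less_imp_le)
  then show ?thesis
    using \<open>C > 0\<close> \<open>D > 0\<close> by (intro exI[of _ "C * D"]) simp
qed

lemma cauchy_poly_add:
  "cauchy_poly q (m + n) y x = cauchy_poly q m y x * cauchy_poly q n y (q ^ m * x)"
  unfolding cauchy_poly_def by (induction n) (auto simp: power_add mult_ac)

lemma cauchy_poly_eq_qpoch:
  "y \<noteq> 0 \<Longrightarrow> cauchy_poly q n y x = y ^ n * qpoch (x / y) q n"
proof (induction n)
  case (Suc n)
  have "y * (1 - x / y * q ^ n) = y - q ^ n * x"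
    using Suc.prems by (simp add: right_diff_distrib)
  then show ?case
    using Suc by (simp add: cauchy_poly_def qpoch_def mult_ac)
qed (simp add: cauchy_poly_def qpoch_def)

text \<open>
  The case \<open>y = 0\<close> produces the factor \<open>q^(n choose 2)\<close>, so the estimates below, stated for general
  \<open>y\<close>, also cover Euler's q-exponential series and the coefficients of the operator.
\<close>

lemma cauchy_poly_0_left:
  "cauchy_poly q n 0 x = (-1) ^ n * q ^ (n choose 2) * x ^ n"
  unfolding cauchy_poly_def
  by (induction n) (auto simp: numeral_2_eq_2 power_add mult_ac)

lemma cauchy_poly_mult:
  "cauchy_poly q n (y * c) (x * c) = cauchy_poly q n y x * c ^ n"
  unfolding cauchy_poly_def by (induction n) (auto simp: algebra_simps)

text \<open>
  Ratio test: consecutive terms have the quotient \<open>(y - q\<^sup>n x) t\<close>, which tends to \<open>y t\<close>.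
\<close>

lemma abs_summable_cauchy_poly:
  assumes "cmod (y * t) < 1"
  shows "summable (\<lambda>n. cmod (cauchy_poly q n y x * t ^ n))"
proof -
  obtain c where c: "cmod (y * t) < c" "c < 1"
    using assms dense by blast
  have "(\<lambda>n. cmod ((y - q ^ n * x) * t)) \<longlonglongrightarrow> cmod ((y - 0 * x) * t)"
    using norm_q_less_1 by (intro tendsto_intros LIMSEQ_power_zero) simp
  then have "eventually (\<lambda>n. cmod ((y - q ^ n * x) * t) < c) sequentially"
    using c by (intro order_tendstoD) simp_all
  then obtain N where N: "\<And>n. n \<ge> N \<Longrightarrow> cmod ((y - q ^ n * x) * t) < c"
    unfolding eventually_sequentially by blast
  show ?thesis
  proof (rule summable_ratio_test[OF c(2)])
    fix n assume "n \<ge> N"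
    have "cauchy_poly q (Suc n) y x * t ^ Suc n
        = ((y - q ^ n * x) * t) * (cauchy_poly q n y x * t ^ n)"
      by (simp add: cauchy_poly_def)
    then have "cmod (cauchy_poly q (Suc n) y x * t ^ Suc n)
        = cmod ((y - q ^ n * x) * t) * cmod (cauchy_poly q n y x * t ^ n)"
      by (simp only: norm_mult)
    also have "\<dots> \<le> c * cmod (cauchy_poly q n y x * t ^ n)"
      using N[OF \<open>n \<ge> N\<close>] by (intro mult_right_mono) auto
    finally show "norm (cmod (cauchy_poly q (Suc n) y x * t ^ Suc n))
        \<le> c * norm (cmod (cauchy_poly q n y x * t ^ n))"
      by simp
  qed
qed

lemma abs_summable_q_binomial:
  assumes "cmod (y * t) < 1"
  shows "summable (\<lambda>n. cmod (cauchy_poly q n y x * (t ^ n / qpoch q q n)))"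
proof -
  obtain C where C: "C > 0" "\<And>n. cmod (inverse (qpoch q q n)) \<le> C"
    using inverse_qpoch_bounded by blast
  have "norm (cmod (cauchy_poly q n y x * (t ^ n / qpoch q q n)))
      \<le> C * cmod (cauchy_poly q n y x * t ^ n)" for n
    using mult_left_mono[OF C(2)[of n], of "cmod (cauchy_poly q n y x * t ^ n)"]
    by (simp add: divide_inverse norm_mult mult_ac)
  then show ?thesis
    by (rule summable_comparison_test'[OF summable_mult[OF abs_summable_cauchy_poly[OF assms]]])
qed

text \<open>
  The coefficients \<open>c\<^sub>n\<close> of the series \<open>f\<close> satisfy \<open>c\<^sub>n\<^sub>+\<^sub>1 (1 - q\<^sup>n\<^sup>+\<^sup>1) = c\<^sub>n (y - q\<^sup>n x)\<close>, which is the
  functional equation \<open>(1 - yz) f(z) = (1 - xz) f(qz)\<close>.  Iterating it expresses \<open>f(t)\<close> by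
  \<open>f(q\<^sup>N t)\<close>, and this tends to \<open>f(0) = 1\<close> by continuity.  For \<open>y \<noteq> 0\<close> this is Cauchy's theorem with
  parameter \<open>x / y\<close> at the argument \<open>y t\<close>; the homogeneous form includes Euler's case \<open>y = 0\<close>.
\<close>

theorem q_binomial_theorem:
  assumes "cmod (y * t) < 1"
  shows "(\<lambda>n. cauchy_poly q n y x * (t ^ n / qpoch q q n))
           sums (qpoch_inf (x * t) q / qpoch_inf (y * t) q)"
proof -
  define c where "c n = cauchy_poly q n y x / qpoch q q n" for n
  define f where "f z = (\<Sum>n. c n * z ^ n)" for z
  have summable_c: "summable (\<lambda>n. c n * z ^ n)" if "cmod (y * z) < 1" for z
    using summable_norm_cancel[OF abs_summable_q_binomial[OF that, of x]] by (simp add: c_def)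
  have in_disc: "cmod (y * (q ^ N * z)) < 1" if "cmod (y * z) < 1" for N z
  proof -
    have "cmod (y * (q ^ N * z)) = cmod (y * z) * cmod q ^ N"
      by (simp add: norm_mult norm_power)
    also have "\<dots> \<le> cmod (y * z) * 1"
      using norm_q_less_1 by (intro mult_left_mono power_le_one) auto
    finally show ?thesis
      using that by simp
  qed
  have rec: "c (Suc n) * (1 - q ^ Suc n) = c n * (y - q ^ n * x)" for n
  proof -
    have "qpoch q q (Suc n) = qpoch q q n * (1 - q ^ Suc n)"
      by (simp add: qpoch_def)
    moreover have "cauchy_poly q (Suc n) y x = cauchy_poly q n y x * (y - q ^ n * x)"
      by (simp add: cauchy_poly_def)
    ultimately show ?thesis
      using qpoch_q_nonzero[of "Suc n"] unfolding c_def by simp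
  qed
  have step: "(1 - y * z) * f z = (1 - x * z) * f (q * z)" if z: "cmod (y * z) < 1" for z
  proof -
    have s: "(\<lambda>n. c n * z ^ n) sums f z" "(\<lambda>n. c n * (q * z) ^ n) sums f (q * z)"
      using summable_c[OF z] summable_c[of "q * z"] in_disc[OF z, of 1]
      unfolding f_def by (simp_all add: summable_sums)
    have "(\<lambda>n. c n * (1 - q ^ n) * z ^ n) sums (f z - f (q * z))"
      using sums_diff[OF s] by (simp add: algebra_simps power_mult_distrib)
    then have "(\<lambda>n. c (Suc n) * (1 - q ^ Suc n) * z ^ Suc n) sums (f z - f (q * z))"
      by (subst sums_Suc_iff) simp
    moreover have "(\<lambda>n. c n * (y - q ^ n * x) * z ^ Suc n) sums (z * (y * f z - x * f (q * z)))"
      using sums_mult[OF sums_diff[OF sums_mult[OF s(1), of y] sums_mult[OF s(2), of x]], of z]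
      by (simp add: algebra_simps power_mult_distrib)
    ultimately have "f z - f (q * z) = z * (y * f z - x * f (q * z))"
      unfolding rec by (rule sums_unique2)
    then show ?thesis
      by (simp add: algebra_simps)
  qed
  have iterate: "qpoch (y * t) q N * f t = qpoch (x * t) q N * f (q ^ N * t)" for N
  proof (induction N)
    case 0
    show ?case by (simp add: qpoch_def)
  next
    case (Suc N)
    have "qpoch (y * t) q (Suc N) * f t = qpoch (x * t) q N * ((1 - y * (q ^ N * t)) * f (q ^ N * t))"
      using Suc.IH by (simp add: qpoch_def mult_ac)
    also have "\<dots> = qpoch (x * t) q (Suc N) * f (q ^ Suc N * t)"
      unfolding step[OF in_disc[OF assms]] by (simp add: qpoch_def mult_ac)
    finally show ?case .
  qed
  have "(\<lambda>N. f (q ^ N * t)) \<longlonglongrightarrow> 1"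
  proof (cases "t = 0")
    case True
    then show ?thesis
      using powser_zero[of c] by (simp add: f_def c_def cauchy_poly_def qpoch_def)
  next
    case False
    have "isCont f 0"
      using isCont_powser[OF summable_c[OF assms], of 0] False by (simp add: f_def[abs_def])
    moreover have "f 0 = 1"
      using powser_zero[of c] by (simp add: f_def c_def cauchy_poly_def qpoch_def)
    moreover have "(\<lambda>N. q ^ N * t) \<longlonglongrightarrow> 0"
      using norm_q_less_1 by (intro tendsto_mult_left_zero LIMSEQ_power_zero) simp
    ultimately show ?thesis
      by (metis isCont_tendsto_compose)
  qed
  from tendsto_mult[OF qpoch_tendsto this, of "x * t"]
  have "(\<lambda>N. qpoch (y * t) q N * f t) \<longlonglongrightarrow> qpoch_inf (x * t) q"
    by (simp add: iterate)
  moreover have "(\<lambda>N. qpoch (y * t) q N * f t) \<longlonglongrightarrow> qpoch_inf (y * t) q * f t"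
    by (intro tendsto_mult_right qpoch_tendsto)
  ultimately have "qpoch_inf (x * t) q = qpoch_inf (y * t) q * f t"
    by (rule LIMSEQ_unique)
  then have "f t = qpoch_inf (x * t) q / qpoch_inf (y * t) q"
    using qpoch_inf_nonzero_disc[OF assms] by simp
  moreover have "(\<lambda>n. c n * t ^ n) sums f t"
    using summable_c[OF assms] by (simp add: f_def summable_sums)
  ultimately show ?thesis
    by (simp add: c_def)
qed

lemma euler_q_exponential:
  "(\<lambda>n. cauchy_poly q n 0 x * (t ^ n / qpoch q q n)) sums qpoch_inf (x * t) q"
  using q_binomial_theorem[of 0 t x] by simp

section \<open>The action of the homogeneous q-difference operator\<close>

definition rogers_weight :: "complex \<Rightarrow> complex \<Rightarrow> nat \<times> nat \<Rightarrow> complex" where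
  "rogers_weight s t p = t ^ fst p / qpoch q q (fst p) * (s ^ snd p / qpoch q q (snd p))"

text \<open>
  The function \<open>(b \<theta>)\<^sup>k p\<^sub>N\<close>: each application of \<open>\<theta>\<close> lowers the degree by one and contributes a
  factor \<open>-(1 - q\<^sup>M)\<close>, where \<open>M\<close> is the current degree.  Beyond \<open>k = N\<close> everything is annihilated.
\<close>

definition theta_cauchy :: "complex \<Rightarrow> nat \<Rightarrow> nat \<Rightarrow> complex \<Rightarrow> complex \<Rightarrow> complex" where
  "theta_cauchy b k N x y =
     (if k \<le> N then (- b) ^ k * (qpoch q q N / qpoch q q (N - k)) * cauchy_poly q (N - k) y x else 0)"

definition L_coeff :: "complex \<Rightarrow> nat \<Rightarrow> complex" where
  "L_coeff a k = q ^ (k choose 2) * qpoch a q k / qpoch q q k"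

lemma theta_cauchy_0: "theta_cauchy b 0 N x y = cauchy_poly q N y x"
  using qpoch_q_nonzero by (simp add: theta_cauchy_def)

text \<open>
  The shifts \<open>x \<mapsto> x / q\<close> and \<open>y \<mapsto> q y\<close> agree up to a power of \<open>q\<close> on a homogeneous polynomial, and
  both create the factor \<open>y - x / q\<close>, the negative of the denominator of \<open>\<theta>\<close>.
\<close>

lemma cauchy_poly_shifts:
  "cauchy_poly q (Suc n) y (inverse q * x) = (y - inverse q * x) * cauchy_poly q n y x"
  "cauchy_poly q (Suc n) (q * y) x = q ^ Suc n * (y - inverse q * x) * cauchy_poly q n y x"
proof -
  have *: "y - q ^ Suc i * (inverse q * x) = y - q ^ i * x" for i
    using q_nonzero by simp
  show 1: "cauchy_poly q (Suc n) y (inverse q * x) = (y - inverse q * x) * cauchy_poly q n y x"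
    unfolding cauchy_poly_def prod.lessThan_Suc_shift comp_def * by simp
  have "inverse q * x * q = x"
    using q_nonzero by simp
  then have "cauchy_poly q (Suc n) (q * y) x
      = cauchy_poly q (Suc n) (y * q) (inverse q * x * q)"
    by (simp only: mult.commute)
  also have "\<dots> = cauchy_poly q (Suc n) y (inverse q * x) * q ^ Suc n"
    by (rule cauchy_poly_mult)
  finally show "cauchy_poly q (Suc n) (q * y) x
      = q ^ Suc n * (y - inverse q * x) * cauchy_poly q n y x"
    unfolding 1 by (simp only: mult_ac)
qed

lemma theta_theta_cauchy:
  assumes "inverse q * x \<noteq> y"
  shows "b * theta q (theta_cauchy b k N) x y = theta_cauchy b (Suc k) N x y"
proof (cases "k < N")
  case True
  then obtain n where n: "N - k = Suc n" "N - Suc k = n"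
    by (metis Suc_diff_Suc)
  have "qpoch q q (Suc n) = qpoch q q n * (1 - q ^ Suc n)"
    by (simp add: qpoch_def)
  then have A: "(qpoch q q N / qpoch q q (Suc n)) * (1 - q ^ Suc n) = qpoch q q N / qpoch q q n"
    using qpoch_q_nonzero[of "Suc n"] by simp
  have "(cauchy_poly q (Suc n) y (inverse q * x) - cauchy_poly q (Suc n) (q * y) x)
        = - ((1 - q ^ Suc n) * cauchy_poly q n y x) * (inverse q * x - y)"
    unfolding cauchy_poly_shifts by (simp add: algebra_simps)
  then have "(cauchy_poly q (Suc n) y (inverse q * x) - cauchy_poly q (Suc n) (q * y) x)
        / (inverse q * x - y) = - ((1 - q ^ Suc n) * cauchy_poly q n y x)"
    using assms by simp
  then have "b * theta q (theta_cauchy b k N) x y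
      = b * ((- b) ^ k * (qpoch q q N / qpoch q q (Suc n)) * - ((1 - q ^ Suc n) * cauchy_poly q n y x))"
    using True unfolding theta_def theta_cauchy_def n
    by (simp only: if_True less_imp_le right_diff_distrib[symmetric] times_divide_eq_right[symmetric])
  also have "\<dots> = (- b) ^ Suc k * ((qpoch q q N / qpoch q q (Suc n)) * (1 - q ^ Suc n)) * cauchy_poly q n y x"
    by (simp add: mult_ac)
  also have "\<dots> = theta_cauchy b (Suc k) N x y"
    using True unfolding A theta_cauchy_def n by simp
  finally show ?thesis .
next
  case False
  then show ?thesis
    by (auto simp: theta_def theta_cauchy_def cauchy_poly_def)
qed

text \<open>
  Writing \<open>p\<^sub>N\<^sub>-\<^sub>k(y, x) = y\<^sup>N\<^sup>-\<^sup>k (x/y; q)\<^sub>N\<^sub>-\<^sub>k\<close> separates the growth in \<open>k\<close> from the growth in \<open>N\<close>; all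
  remaining factors are q-shifted factorials and hence bounded.
\<close>

lemma theta_cauchy_bound:
  assumes "y \<noteq> 0"
  shows "\<exists>C>0. \<forall>k N. cmod (theta_cauchy b k N x y) \<le> C * cmod ((b / y) ^ k * y ^ N)"
proof -
  obtain C D where C: "C > 0" "\<And>n k. cmod (qpoch q q n / qpoch q q k) \<le> C"
    and D: "D > 0" "\<And>n. cmod (qpoch (x / y) q n) \<le> D"
    using qpoch_ratio_bounded[of q] qpoch_bounded[of "x / y"] by blast
  have "cmod (theta_cauchy b k N x y) \<le> C * D * cmod ((b / y) ^ k * y ^ N)" for k N
  proof (cases "k \<le> N")
    case True
    have y: "y ^ (N - k) = y ^ N / y ^ k"
      using True assms by (simp add: power_diff)
    have "cmod (theta_cauchy b k N x y)
        = cmod (qpoch q q N / qpoch q q (N - k)) * cmod (qpoch (x / y) q (N - k))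
          * cmod ((b / y) ^ k * y ^ N)"
      using True
      by (simp add: theta_cauchy_def cauchy_poly_eq_qpoch[OF assms] y norm_mult norm_divide
          norm_power power_divide)
    also have "\<dots> \<le> C * D * cmod ((b / y) ^ k * y ^ N)"
      using C D by (intro mult_right_mono mult_mono) auto
    finally show ?thesis .
  next
    case False
    then show ?thesis
      using C(1) D(1) by (simp add: theta_cauchy_def)
  qed
  then show ?thesis
    using C(1) D(1) by (intro exI[of _ "C * D"]) simp
qed

lemma norm_summable_power_over_qpoch:
  assumes "cmod z < 1"
  shows "(\<lambda>n. cmod (z ^ n / qpoch q q n)) summable_on UNIV"
proof -
  have "cmod (z * 1) < 1"
    using assms by simp
  from abs_summable_q_binomial[OF this, of 0] show ?thesis
    by (intro norm_summable_imp_summable_on) (simp add: cauchy_poly_def norm_mult norm_divide norm_power)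
qed

lemma norm_summable_weight:
  assumes "cmod (y * s) < 1" and "cmod (y * t) < 1"
  shows "(\<lambda>p. cmod (y ^ (fst p + snd p) * rogers_weight s t p)) summable_on UNIV"
proof -
  have "y ^ (fst p + snd p) * rogers_weight s t p
      = ((y * t) ^ fst p / qpoch q q (fst p)) * ((y * s) ^ snd p / qpoch q q (snd p))" for p
    by (simp add: rogers_weight_def power_add power_mult_distrib)
  then show ?thesis
    using norm_summable_on_times[OF norm_summable_power_over_qpoch[OF assms(2)]
        norm_summable_power_over_qpoch[OF assms(1)]] by simp
qed

text \<open>
  Up to the bounded quotient of \<open>(a;q)\<^sub>k\<close> and \<open>(q;q)\<^sub>k\<close>, the terms are the Cauchy polynomials
  \<open>p\<^sub>k(0, z)\<close> in absolute value, so \<open>z\<close> may be arbitrary.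
\<close>

lemma norm_summable_L_coeff: "(\<lambda>k. cmod (L_coeff a k * z ^ k)) summable_on UNIV"
proof -
  obtain C where C: "C > 0" "\<And>n k. cmod (qpoch a q n / qpoch q q k) \<le> C"
    using qpoch_ratio_bounded by blast
  have "summable (\<lambda>k. cmod (cauchy_poly q k 0 z * 1 ^ k))"
    by (rule abs_summable_cauchy_poly) simp
  then have "summable (\<lambda>k. C * cmod (cauchy_poly q k 0 z))"
    by (intro summable_mult) simp
  moreover have "norm (cmod (L_coeff a k * z ^ k)) \<le> C * cmod (cauchy_poly q k 0 z)" for k
  proof -
    have "cmod (L_coeff a k * z ^ k) = cmod (qpoch a q k / qpoch q q k) * cmod (cauchy_poly q k 0 z)"
      by (simp add: L_coeff_def cauchy_poly_0_left norm_mult norm_divide norm_power)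
    then show ?thesis
      using C(2)[of k k] by (simp add: mult_right_mono)
  qed
  ultimately have "summable (\<lambda>k. cmod (L_coeff a k * z ^ k))"
    by (rule summable_comparison_test')
  then show ?thesis
    by (intro norm_summable_imp_summable_on) simp
qed

lemma norm_summable_triple_series:
  assumes "y \<noteq> 0" and "cmod (y * s) < 1" and "cmod (y * t) < 1"
  shows "(\<lambda>(k, p). cmod (L_coeff a k * (theta_cauchy b k (fst p + snd p) x y * rogers_weight s t p)))
           summable_on UNIV"
proof -
  obtain C where C: "C > 0" "\<And>k N. cmod (theta_cauchy b k N x y) \<le> C * cmod ((b / y) ^ k * y ^ N)"
    using theta_cauchy_bound[OF assms(1)] by blast
  let ?g = "\<lambda>kp. C * cmod (L_coeff a (fst kp) * (b / y) ^ fst kp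
    * (y ^ (fst (snd kp) + snd (snd kp)) * rogers_weight s t (snd kp)))"
  have "?g summable_on UNIV"
    using norm_summable_on_times[OF norm_summable_L_coeff norm_summable_weight[OF assms(2,3)]]
    by (intro summable_on_cmult_right) simp
  then have "(\<lambda>kp. norm (L_coeff a (fst kp) * (theta_cauchy b (fst kp) (fst (snd kp) + snd (snd kp)) x y
      * rogers_weight s t (snd kp)))) summable_on UNIV"
  proof (rule Infinite_Sum.abs_summable_on_comparison_test')
    fix kp :: "nat \<times> nat \<times> nat"
    obtain k p where kp: "kp = (k, p)" by (cases kp)
    show "norm (L_coeff a (fst kp) * (theta_cauchy b (fst kp) (fst (snd kp) + snd (snd kp)) x y
      * rogers_weight s t (snd kp))) \<le> ?g kp"
      using mult_left_mono[OF C(2)[of k "fst p + snd p"],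
          of "cmod (L_coeff a k) * cmod (rogers_weight s t p)"]
      by (simp add: kp norm_mult mult_ac)
  qed
  then show ?thesis
    by (simp add: case_prod_unfold)
qed

lemma norm_summable_theta_cauchy:
  assumes "y \<noteq> 0" and "cmod (y * s) < 1" and "cmod (y * t) < 1"
  shows "(\<lambda>p. cmod (theta_cauchy b k (fst p + snd p) x y * rogers_weight s t p)) summable_on UNIV"
proof -
  obtain C where C: "C > 0" "\<And>k N. cmod (theta_cauchy b k N x y) \<le> C * cmod ((b / y) ^ k * y ^ N)"
    using theta_cauchy_bound[OF assms(1)] by blast
  have "(\<lambda>p. C * cmod ((b / y) ^ k) * cmod (y ^ (fst p + snd p) * rogers_weight s t p)) summable_on UNIV"
    by (intro summable_on_cmult_right norm_summable_weight assms)
  then show ?thesis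
  proof (rule Infinite_Sum.abs_summable_on_comparison_test')
    show "cmod (theta_cauchy b k (fst p + snd p) x y * rogers_weight s t p)
      \<le> C * cmod ((b / y) ^ k) * cmod (y ^ (fst p + snd p) * rogers_weight s t p)" for p
      using mult_right_mono[OF C(2)[of k "fst p + snd p"], of "cmod (rogers_weight s t p)"]
      by (simp add: norm_mult mult_ac)
  qed
qed

text \<open>
  The admissible points are closed under the two shifts, so identities that hold at all of them
  can be iterated through \<open>\<theta>\<close>, and the denominator of \<open>\<theta>\<close> never vanishes there.
\<close>

lemma admissible_shift:
  assumes "admissible q x y s t"
  shows "admissible q (inverse q * x) y s t" and "admissible q x (q * y) s t"
    and "inverse q * x \<noteq> y"
proof -
  have y: "y \<noteq> 0" "cmod (y * s) < 1" "cmod (y * t) < 1"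
    and xy: "\<And>i j. inverse q ^ Suc i * x \<noteq> q ^ j * y"
    and xs: "\<And>k. x * s \<noteq> q powi k"
    using assms unfolding admissible_def by auto
  have "inverse q ^ Suc i * (inverse q * x) \<noteq> q ^ j * y" for i j
    using xy[of "Suc i" j] by (simp add: mult_ac)
  moreover have "inverse q * x * s \<noteq> q powi k" for k
    using xs[of "k + 1"] q_nonzero by (auto simp: power_int_add field_simps)
  ultimately show "admissible q (inverse q * x) y s t"
    using y unfolding admissible_def by blast
  have "cmod (q * y * c) < 1" if "cmod (y * c) < 1" for c
  proof -
    have "cmod (q * y * c) = cmod q * cmod (y * c)"
      by (simp add: norm_mult)
    also have "\<dots> \<le> 1 * cmod (y * c)"
      using norm_q_less_1 by (intro mult_right_mono) auto
    finally show ?thesis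
      using that by simp
  qed
  moreover have "inverse q ^ Suc i * x \<noteq> q ^ j * (q * y)" for i j
    using xy[of i "Suc j"] by (simp add: mult_ac)
  ultimately show "admissible q x (q * y) s t"
    using y xs q_nonzero unfolding admissible_def by simp
  show "inverse q * x \<noteq> y"
    using xy[of 0 0] by simp
qed

lemma admissible_imp_nonzero_factors:
  assumes "admissible q x y s t"
  shows "x * s * q ^ i \<noteq> 1"
proof
  assume "x * s * q ^ i = 1"
  then have "x * s = q powi (- int i)"
    using q_nonzero by (simp add: power_int_minus field_simps)
  then show False
    using assms unfolding admissible_def by blast
qed

text \<open>
  A value of \<open>\<theta>\<close> at an admissible point is a multiple of the difference of two values at admissible
  points.  Both are absolutely convergent series, so \<open>\<theta>\<close> can be applied term by term.
\<close>

lemma theta_iterate: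
  assumes f: "\<forall>x y. admissible q x y s t \<longrightarrow>
      f x y = (\<Sum>\<^sub>\<infinity>p. cauchy_poly q (fst p + snd p) y x * rogers_weight s t p)"
    and "admissible q x y s t"
  shows "((\<lambda>g u v. b * theta q g u v) ^^ k) f x y
           = (\<Sum>\<^sub>\<infinity>p. theta_cauchy b k (fst p + snd p) x y * rogers_weight s t p)"
  using assms(2)
proof (induction k arbitrary: x y)
  case 0
  then show ?case by (simp add: theta_cauchy_0 f)
next
  case (Suc k)
  note shift = admissible_shift[OF Suc.prems]
  define S where "S u v = (\<lambda>p. theta_cauchy b k (fst p + snd p) u v * rogers_weight s t p)" for u v
  have "S u v summable_on UNIV" if "admissible q u v s t" for u v
    using that abs_summable_summable[OF norm_summable_theta_cauchy]
    unfolding S_def admissible_def by blast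
  then have sums: "(S (inverse q * x) y has_sum infsum (S (inverse q * x) y) UNIV) UNIV"
    "(S x (q * y) has_sum infsum (S x (q * y)) UNIV) UNIV"
    using shift(1,2) by simp_all
  define d where "d = b / (inverse q * x - y)"
  have "((\<lambda>p. d * (S (inverse q * x) y p + (-1) * S x (q * y) p)) has_sum
      d * (infsum (S (inverse q * x) y) UNIV + (-1) * infsum (S x (q * y)) UNIV)) UNIV"
    by (intro has_sum_cmult_right has_sum_add sums)
  moreover have "d * (S (inverse q * x) y p + (-1) * S x (q * y) p)
      = theta_cauchy b (Suc k) (fst p + snd p) x y * rogers_weight s t p" for p
    unfolding theta_theta_cauchy[OF shift(3), symmetric]
    by (simp add: theta_def S_def d_def left_diff_distrib)
  ultimately have "(\<Sum>\<^sub>\<infinity>p. theta_cauchy b (Suc k) (fst p + snd p) x y * rogers_weight s t p)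
      = d * (infsum (S (inverse q * x) y) UNIV - infsum (S x (q * y)) UNIV)"
    by (simp add: infsumI)
  also have "\<dots> = b * theta q (((\<lambda>g u v. b * theta q g u v) ^^ k) f) x y"
    unfolding theta_def[of q "(_ ^^ k) f"] Suc.IH[OF shift(1)] Suc.IH[OF shift(2)]
    by (simp add: S_def d_def)
  finally show ?case
    by simp
qed

lemma gen_hahn_eq_theta_cauchy:
  "gen_hahn q N x y a b = (\<Sum>k\<le>N. L_coeff a k * theta_cauchy b k N x y)"
  unfolding gen_hahn_def
proof (rule sum.cong)
  fix k assume "k \<in> {..N}"
  then show "qbinomial q N k * (-1) ^ k * q ^ (k choose 2) * b ^ k * qpoch a q k
      * cauchy_poly q (N - k) y x = L_coeff a k * theta_cauchy b k N x y"
    by (simp add: qbinomial_def L_coeff_def theta_cauchy_def power_minus[of b])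
qed simp

text \<open>
  The Rogers-type formula for an arbitrary closed form \<open>f\<close> of the double series.  The triple series
  \<open>u\<close>, indexed by \<open>(k, (n, m))\<close>, gives the operator series when \<open>(n, m)\<close> is summed first, and the
  series of Hahn polynomials when \<open>k\<close> is summed first.
\<close>

theorem rogers_formula:
  fixes a b :: complex
  assumes f: "\<forall>x y. admissible q x y s t \<longrightarrow>
      f x y = (\<Sum>\<^sub>\<infinity>p. cauchy_poly q (fst p + snd p) y x * rogers_weight s t p)"
    and adm: "admissible q x y s t"
  defines "H \<equiv> \<lambda>n m. gen_hahn q (n + m) x y a b
                       * (t ^ n / qpoch q q n) * (s ^ m / qpoch q q m)"
  shows "summable (H n)" and "summable (\<lambda>n. \<Sum>m. H n m)"
    and "summable (L_term q a b f x y)"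
    and "(\<Sum>n. \<Sum>m. H n m) = L_op q a b f x y"
proof -
  have y: "y \<noteq> 0" "cmod (y * s) < 1" "cmod (y * t) < 1"
    using adm unfolding admissible_def by auto
  define u where
    "u kp = L_coeff a (fst kp) * (theta_cauchy b (fst kp) (fst (snd kp) + snd (snd kp)) x y
       * rogers_weight s t (snd kp))" for kp
  have norm_u: "(\<lambda>kp. norm (u kp)) summable_on UNIV \<times> UNIV"
    using norm_summable_triple_series[OF y, of a b x] by (simp add: u_def case_prod_unfold)
  then have u: "u summable_on UNIV \<times> UNIV"
    by (rule abs_summable_summable)
  have L_term: "L_term q a b f x y k = (\<Sum>\<^sub>\<infinity>p. u (k, p))" for k
    unfolding L_term_def theta_iterate[OF f adm]
    by (simp add: u_def L_coeff_def infsum_cmult_right'[symmetric])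
  have "(\<lambda>k. \<Sum>\<^sub>\<infinity>p. u (k, p)) summable_on UNIV"
    using summable_on_Sigma_banach[of "\<lambda>k p. u (k, p)" UNIV "\<lambda>_. UNIV"] u by simp
  then have L_summable: "L_term q a b f x y summable_on UNIV"
    unfolding L_term by simp
  then show "summable (L_term q a b f x y)"
    by (rule summable_on_imp_summable)
  have u': "(\<lambda>pk. u (snd pk, fst pk)) summable_on UNIV \<times> UNIV"
    and norm_u': "(\<lambda>pk. norm (u (snd pk, fst pk))) summable_on UNIV \<times> UNIV"
    using u norm_u summable_on_swap[of u UNIV UNIV] summable_on_swap[of "\<lambda>kp. norm (u kp)" UNIV UNIV]
    by (simp_all add: case_prod_unfold)
  have H: "((\<lambda>k. u (k, (n, m))) has_sum H n m) UNIV" for n m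
  proof (rule has_sum_finite_neutralI[of "{..n + m}"])
    have "H n m = gen_hahn q (n + m) x y a b * rogers_weight s t (n, m)"
      by (simp add: H_def rogers_weight_def)
    then show "H n m = (\<Sum>k\<le>n + m. u (k, n, m))"
      by (simp add: u_def gen_hahn_eq_theta_cauchy sum_distrib_right mult.assoc)
  qed (auto simp: u_def theta_cauchy_def)
  have H_infsum: "(\<Sum>\<^sub>\<infinity>k. u (k, p)) = H (fst p) (snd p)" for p
    using H[of "fst p" "snd p"] by (simp add: infsumI)
  have "(\<lambda>p. norm (H (fst p) (snd p))) summable_on UNIV"
  proof (rule Infinite_Sum.abs_summable_on_comparison_test')
    show "(\<lambda>p. \<Sum>\<^sub>\<infinity>k. norm (u (k, p))) summable_on UNIV"
      using summable_on_Sigma_banach[of "\<lambda>p k. norm (u (k, p))" UNIV "\<lambda>_. UNIV"] norm_u'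
      by (simp add: case_prod_unfold)
    have "(\<lambda>k. norm (u (k, p))) summable_on UNIV" for p
      using Infinite_Sum.abs_summable_on_Sigma_iff[THEN iffD1, OF norm_u'] by (cases p) simp
    then show "norm (H (fst p) (snd p)) \<le> (\<Sum>\<^sub>\<infinity>k. norm (u (k, p)))" for p
      unfolding H_infsum[symmetric] by (rule norm_infsum_bound)
  qed
  note double = norm_summable_on_double_series[OF this]
  show "summable (H n)" "summable (\<lambda>n. \<Sum>m. H n m)"
    using double(1)[of n] double(2) by simp_all
  have "(\<Sum>n. \<Sum>m. H n m) = (\<Sum>\<^sub>\<infinity>p. H (fst p) (snd p))"
    using double(3) by simp
  also have "\<dots> = (\<Sum>\<^sub>\<infinity>p. \<Sum>\<^sub>\<infinity>k. u (k, p))"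
    by (simp add: H_infsum)
  also have "\<dots> = (\<Sum>\<^sub>\<infinity>k. \<Sum>\<^sub>\<infinity>p. u (k, p))"
    using infsum_swap_banach[of "\<lambda>k p. u (k, p)" UNIV UNIV] u by simp
  also have "\<dots> = L_op q a b f x y"
    unfolding L_op_def infsum_nat_eq_suminf[OF L_summable, symmetric] L_term ..
  finally show "(\<Sum>n. \<Sum>m. H n m) = L_op q a b f x y" .
qed

section \<open>Closed forms of the double series\<close>

text \<open>
  After the sum over \<open>m\<close>, the \<open>n\<close>-dependence of the product \<open>(q\<^sup>n x s; q)\<^sub>\<infinity>\<close> is
  \<open>1 / (x s; q)\<^sub>n\<close>, which supplies the lower parameter of the \<open>\<^sub>2\<Phi>\<^sub>1\<close>.
\<close>

lemma cauchy_gf_eq_2Phi1: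
  assumes adm: "admissible q x y s t"
  shows "qpoch_inf (x * s) q / qpoch_inf (y * s) q * basic_hypergeom [x / y, 0] [x * s] q (y * t)
           = (\<Sum>\<^sub>\<infinity>p. cauchy_poly q (fst p + snd p) y x * rogers_weight s t p)"
proof -
  have y: "y \<noteq> 0" "cmod (y * s) < 1" "cmod (y * t) < 1"
    using adm unfolding admissible_def by auto
  note xs = admissible_imp_nonzero_factors[OF adm]
  note double = norm_summable_on_double_series[OF norm_summable_theta_cauchy[OF y, where k = 0 and x = x],
      unfolded theta_cauchy_0]
  define A where "A = qpoch_inf (x * s) q / qpoch_inf (y * s) q"
  define h where "h n = qpoch (x / y) q n / qpoch (x * s) q n * ((y * t) ^ n / qpoch q q n)" for n
  have inner: "(\<Sum>m. cauchy_poly q (n + m) y x * rogers_weight s t (n, m)) = A * h n" for n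
  proof -
    have "(\<lambda>m. cauchy_poly q m y (q ^ n * x) * (s ^ m / qpoch q q m))
        sums (qpoch_inf (q ^ n * x * s) q / qpoch_inf (y * s) q)"
      by (rule q_binomial_theorem[OF y(2)])
    from sums_mult[OF this, of "cauchy_poly q n y x * (t ^ n / qpoch q q n)"]
    have "(\<Sum>m. cauchy_poly q (n + m) y x * rogers_weight s t (n, m))
        = cauchy_poly q n y x * (t ^ n / qpoch q q n)
          * (qpoch_inf (q ^ n * x * s) q / qpoch_inf (y * s) q)"
      by (simp add: sums_iff cauchy_poly_add rogers_weight_def mult_ac)
    also have "qpoch_inf (q ^ n * x * s) q = qpoch_inf (x * s) q / qpoch (x * s) q n"
      using qpoch_inf_split[of "x * s" n] qpoch_nonzero[OF xs, of n] by (simp add: mult_ac)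
    finally show ?thesis
      using y(1) by (simp add: A_def h_def cauchy_poly_eq_qpoch power_mult_distrib mult_ac)
  qed
  have "A \<noteq> 0"
    using qpoch_inf_nonzero[OF xs] qpoch_inf_nonzero_disc[OF y(2)] by (simp add: A_def)
  have "summable (\<lambda>n. A * h n)"
    using double(2) by (simp add: inner)
  then have "summable h"
    using \<open>A \<noteq> 0\<close> by (simp add: summable_cmult_iff)
  have "(\<Sum>\<^sub>\<infinity>p. cauchy_poly q (fst p + snd p) y x * rogers_weight s t p) = (\<Sum>n. A * h n)"
    using double(3) by (simp add: inner)
  also have "\<dots> = A * (\<Sum>n. h n)"
    by (rule suminf_mult[OF \<open>summable h\<close>])
  also have "(\<Sum>n. h n) = basic_hypergeom [x / y, 0] [x * s] q (y * t)"
    by (simp add: basic_hypergeom_def qpochs_def h_def)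
  finally show ?thesis
    by (simp add: A_def)
qed

text \<open>
  The auxiliary double series \<open>v\<close> couples Euler's series in \<open>t\<close> and the q-binomial series in \<open>s\<close> by
  the factor \<open>q\<^sup>k\<^sup>m\<close>.  This factor can be absorbed into either argument: absorbed into \<open>s\<close>, the sum
  over \<open>m\<close> yields the terms of the \<open>\<^sub>1\<Phi>\<^sub>1\<close>; absorbed into \<open>t\<close>, the sum over \<open>k\<close> yields
  \<open>(xtq\<^sup>m; q)\<^sub>\<infinity>\<close>, which is what the q-binomial theorem produces from the sum over \<open>n\<close>.
\<close>

lemma cauchy_gf_eq_1Phi1:
  assumes adm: "admissible q x y s t"
  shows "qpoch_inf (x * s) q / qpochs_inf [y * t, y * s] q * basic_hypergeom [y * s] [x * s] q (x * t)
           = (\<Sum>\<^sub>\<infinity>p. cauchy_poly q (fst p + snd p) y x * rogers_weight s t p)"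
proof -
  have y: "y \<noteq> 0" "cmod (y * s) < 1" "cmod (y * t) < 1"
    using adm unfolding admissible_def by auto
  note xs = admissible_imp_nonzero_factors[OF adm]
  have norm_q: "cmod (q ^ k) \<le> 1" for k
    using norm_q_less_1 by (simp add: norm_power power_le_one)
  define A where "A k = cauchy_poly q k 0 x * (t ^ k / qpoch q q k)" for k
  define B where "B m = cauchy_poly q m y x * (s ^ m / qpoch q q m)" for m
  define v where "v p = A (fst p) * B (snd p) * q ^ (fst p * snd p)" for p
  have norm_A: "(\<lambda>k. norm (A k)) summable_on UNIV"
    unfolding A_def by (intro norm_summable_imp_summable_on)
      (use abs_summable_q_binomial[of 0 t x] in simp)
  have norm_B: "(\<lambda>m. norm (B m)) summable_on UNIV"
    unfolding B_def by (intro norm_summable_imp_summable_on)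
      (use abs_summable_q_binomial[OF y(2)] in simp)
  have norm_v: "(\<lambda>p. norm (v p)) summable_on UNIV"
  proof (rule Infinite_Sum.abs_summable_on_comparison_test')
    show "(\<lambda>p. norm (A (fst p) * B (snd p))) summable_on UNIV"
      using norm_summable_on_times[OF norm_A norm_B] by simp
    show "norm (v p) \<le> norm (A (fst p) * B (snd p))" for p
      using mult_left_mono[OF norm_q, of "norm (A (fst p) * B (snd p))"]
      by (simp add: v_def norm_mult)
  qed
  have norm_v': "(\<lambda>p. norm (v (snd p, fst p))) summable_on UNIV"
    using norm_v summable_on_swap[of "\<lambda>p. norm (v p)" UNIV UNIV] by (simp add: case_prod_unfold)
  have sum_over_m: "(\<Sum>m. v (k, m)) = A k * (qpoch_inf (x * s * q ^ k) q / qpoch_inf (y * s * q ^ k) q)" for k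
  proof -
    have "cmod (y * (s * q ^ k)) < 1"
      using mult_left_mono[OF norm_q[of k], of "cmod (y * s)"] y(2)
      by (simp add: norm_mult mult_ac)
    from sums_mult[OF q_binomial_theorem[OF this, of x], of "A k"] show ?thesis
      by (simp add: sums_iff v_def B_def power_mult_distrib power_mult[symmetric] mult_ac)
  qed
  have sum_over_k: "(\<Sum>k. v (k, m)) = B m * qpoch_inf (x * t * q ^ m) q" for m
    using sums_mult[OF euler_q_exponential[of x "t * q ^ m"], of "B m"]
    by (simp add: sums_iff v_def A_def power_mult_distrib power_mult[symmetric] mult_ac)
  define h where "h k = (-1) ^ k * q ^ (k choose 2)
      * (qpoch (y * s) q k / qpoch (x * s) q k) * ((x * t) ^ k / qpoch q q k)" for k
  have h: "qpoch_inf (x * s) q / qpoch_inf (y * s) q * h k = (\<Sum>m. v (k, m))" for k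
  proof -
    have "qpoch (y * s) q k \<noteq> 0"
      by (intro qpoch_nonzero mult_power_q_neq_1 y)
    then show ?thesis
      using qpoch_nonzero[OF xs, of k]
      unfolding sum_over_m qpoch_inf_split[of "x * s" k] qpoch_inf_split[of "y * s" k]
      by (simp add: h_def A_def cauchy_poly_0_left power_mult_distrib mult_ac)
  qed
  have nonzero: "qpoch_inf (x * s) q \<noteq> 0" "qpoch_inf (y * s) q \<noteq> 0" "qpoch_inf (y * t) q \<noteq> 0"
    using qpoch_inf_nonzero[OF xs] qpoch_inf_nonzero_disc y by auto
  have "summable (\<lambda>k. qpoch_inf (x * s) q / qpoch_inf (y * s) q * h k)"
    unfolding h by (rule norm_summable_on_double_series(2)[OF norm_v])
  then have "summable h"
    using nonzero by (simp only: summable_cmult_iff) auto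
  \<comment> \<open>Here the splitting is \<open>p\<^sub>m\<^sub>+\<^sub>n(y, x) = p\<^sub>m(y, x) p\<^sub>n(y, q\<^sup>m x)\<close>, with the index of \<open>s\<close> first.\<close>
  have row: "(\<Sum>n. cauchy_poly q (n + m) y x * rogers_weight s t (n, m))
      = B m * (qpoch_inf (x * t * q ^ m) q / qpoch_inf (y * t) q)" for m
    using sums_mult[OF q_binomial_theorem[OF y(3), of "q ^ m * x"], of "B m"]
    by (simp add: sums_iff B_def rogers_weight_def add.commute[of _ m] cauchy_poly_add mult_ac)
  let ?c = "\<lambda>p. cauchy_poly q (fst p + snd p) y x * rogers_weight s t p"
  have norm_c: "(\<lambda>p. norm (?c p)) summable_on UNIV"
    using norm_summable_theta_cauchy[OF y, where k = 0 and x = x] by (simp only: theta_cauchy_0)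
  have norm_c': "(\<lambda>p. norm (?c (snd p, fst p))) summable_on UNIV"
    using norm_c summable_on_swap[of "\<lambda>p. norm (?c p)" UNIV UNIV] by (simp add: case_prod_unfold)
  have swap: "(\<Sum>\<^sub>\<infinity>p. g (snd p, fst p)) = infsum g UNIV" for g :: "nat \<times> nat \<Rightarrow> complex"
  proof -
    have "g \<circ> prod.swap = (\<lambda>p. g (snd p, fst p))"
      by (simp add: fun_eq_iff prod.swap_def)
    then show ?thesis
      using infsum_reindex[of prod.swap UNIV g] by (simp add: surj_swap)
  qed
  have "(\<Sum>\<^sub>\<infinity>p. ?c p) = (\<Sum>m. B m * (qpoch_inf (x * t * q ^ m) q / qpoch_inf (y * t) q))"
    using norm_summable_on_double_series(3)[OF norm_c'] by (simp add: swap[of ?c, simplified] row)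
  also have "\<dots> = (\<Sum>m. (\<Sum>k. v (k, m)) / qpoch_inf (y * t) q)"
    by (simp add: sum_over_k)
  also have "\<dots> = (\<Sum>m. \<Sum>k. v (k, m)) / qpoch_inf (y * t) q"
    using norm_summable_on_double_series(2)[OF norm_v'] by (intro suminf_divide) simp
  also have "(\<Sum>m. \<Sum>k. v (k, m)) = (\<Sum>k. \<Sum>m. v (k, m))"
    using norm_summable_on_double_series(3)[OF norm_v'] norm_summable_on_double_series(3)[OF norm_v]
    by (simp add: swap)
  also have "\<dots> = qpoch_inf (x * s) q / qpoch_inf (y * s) q * (\<Sum>k. h k)"
    unfolding h[symmetric] by (rule suminf_mult[OF \<open>summable h\<close>])
  also have "(\<Sum>k. h k) = basic_hypergeom [y * s] [x * s] q (x * t)"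
    by (simp add: basic_hypergeom_def qpochs_def h_def)
  finally show ?thesis
    by (simp add: qpochs_inf_def)
qed

end

theorem theorem3p4:
  fixes q :: real and x y a b s t :: complex
  assumes "0 < q" and "q < 1"
    and "admissible q x y s t"
  defines "F \<equiv> \<lambda>x y. qpoch_inf (x * s) q / qpoch_inf (y * s) q
                       * basic_hypergeom [x / y, 0] [x * s] q (y * t)"
    and "G \<equiv> \<lambda>x y. qpoch_inf (x * s) q / qpochs_inf [y * t, y * s] q
                       * basic_hypergeom [y * s] [x * s] q (x * t)"
    and "H \<equiv> \<lambda>n m. gen_hahn q (n + m) x y a b
                       * (t ^ n / qpoch q q n) * (s ^ m / qpoch q q m)"
  shows "(\<forall>n. summable (\<lambda>m. H n m)) \<and> summable (\<lambda>n. \<Sum>m. H n m)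
       \<and> summable (L_term q a b F x y) \<and> summable (L_term q a b G x y)
       \<and> (\<Sum>n. \<Sum>m. H n m) = L_op q a b F x y
       \<and> L_op q a b F x y = L_op q a b G x y"
proof -
  interpret q_base "complex_of_real q"
    using assms(1,2) by unfold_locales simp_all
  have "\<forall>x y. admissible q x y s t \<longrightarrow>
      F x y = (\<Sum>\<^sub>\<infinity>p. cauchy_poly q (fst p + snd p) y x * rogers_weight s t p)"
    unfolding F_def using cauchy_gf_eq_2Phi1 by blast
  note F = rogers_formula[OF this assms(3), where a = a and b = b]
  have "\<forall>x y. admissible q x y s t \<longrightarrow>
      G x y = (\<Sum>\<^sub>\<infinity>p. cauchy_poly q (fst p + snd p) y x * rogers_weight s t p)"
    unfolding G_def using cauchy_gf_eq_1Phi1 by blast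
  note G = rogers_formula[OF this assms(3), where a = a and b = b]
  show ?thesis
    unfolding H_def using F G by simp
qed

end
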